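(* For every integer $d\ge 1$, $$1\le \alpha(d)\le 1+6\left(\tfrac{3}{4}\right)^{d/2},$$ where $\alpha(d)=\mathbb{E}\left[2/W^2\right]$ with $$W=\frac{\lambda\left(B_{\overline{1},1}\cup B_{Y,\|Y\|}\right)}{\lambda(B_{0,1})},$$ $Y$ being a random vector uniformly distributed in the unit ball $B_{0,1}\subset\mathbb{R}^d$ and $\overline{1}=(1,0,\ldots,0)\in\mathbb{R}^d$.
   Context: $\|\cdot\|$ is the Euclidean norm on $\mathbb{R}^d$, $\lambda$ is Lebesgue measure on $\mathbb{R}^d$, and $B_{x,r}$ is the closed ball of radius $r$ centered at $x\in\mathbb{R}^d$. *)

theory Defs
  imports "HOL-Probability.Probability"
begin

text \<open>
  The space \<open>\<real>\<^sup>d\<close> is \<open>real ^ 'n\<close> with \<open>d = CARD('n)\<close>. Since \<open>'n\<close> is an arbitrary finite type, it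
  has no distinguished first element; the index \<open>k\<close> plays that role, so that \<open>axis k 1\<close>
  is the vector \<open>(1, 0, \<dots>, 0)\<close> when \<open>k\<close> is enumerated first.
\<close>

definition union_ratio :: "'n::finite \<Rightarrow> real ^ 'n \<Rightarrow> real" where
  "union_ratio k y =
     measure lebesgue (cball (axis k 1) 1 \<union> cball y (norm y))
       / measure lebesgue (cball (0 :: real ^ 'n) 1)"

definition uniform_unit_ball :: "'w measure \<Rightarrow> ('w \<Rightarrow> real ^ 'n::finite) \<Rightarrow> bool" where
  "uniform_unit_ball M Y \<longleftrightarrow>
     Y \<in> borel_measurable M \<and> distr M borel Y = uniform_measure lborel (cball 0 1)"

definition alpha :: "'n::finite \<Rightarrow> 'w measure \<Rightarrow> ('w \<Rightarrow> real ^ 'n) \<Rightarrow> real" where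
  "alpha k M Y = prob_space.expectation M (\<lambda>\<omega>. 2 / (union_ratio k (Y \<omega>))\<^sup>2)"

end

theory Submission
  imports Defs
begin

text \<open>
  Write \<open>V\<close> for the volume of the unit ball, \<open>U = \<parallel>Y\<parallel>\<^sup>d\<close> and \<open>I\<close> for the volume of
  \<open>B\<^bsub>e,1\<^esub> \<inter> B\<^bsub>Y,\<parallel>Y\<parallel>\<^esub>\<close> divided by \<open>V\<close>, so that \<open>W = 1 + U - I\<close> with \<open>0 \<le> I \<le> U\<close>. Then
  \<open>2 / (1 + U)\<^sup>2 \<le> 2 / W\<^sup>2 \<le> 2 / (1 + U)\<^sup>2 + 4 I\<close>; as \<open>U\<close> is uniform on \<open>[0, 1]\<close>, the
  expectation of \<open>2 / (1 + U)\<^sup>2\<close> is \<open>1\<close>. By Fubini, \<open>E I\<close> is the integral over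
  \<open>z \<in> B\<^bsub>e,1\<^esub>\<close> of the volume of the cap \<open>{y. \<parallel>y\<parallel> \<le> 1, \<parallel>z\<parallel>\<^sup>2 \<le> 2 z \<bullet> y}\<close>, divided by \<open>V\<^sup>2\<close>. For
  \<open>\<parallel>z\<parallel> \<ge> 1\<close> the cap lies in the ball of radius \<open>\<surd>(3/4)\<close> about \<open>z/2\<close>; for \<open>\<parallel>z\<parallel> < 1\<close> it
  has volume at most \<open>V / 2\<close>, and such \<open>z\<close> lie in the ball of radius \<open>\<surd>(3/4)\<close> about
  \<open>e/2\<close>. Together \<open>E I \<le> 3/2 (3/4)\<^bsup>d/2\<^esup>\<close>.
\<close>

section \<open>Preliminaries: balls in terms of inner products\<close>

lemma unit_ball_vol_of_nat_neq_0 [simp]: "unit_ball_vol (real n) \<noteq> 0"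
  using unit_ball_vol_pos[of "real n"] by linarith

text \<open>The sphere about \<open>y\<close> passes through the origin, so
  \<open>y \<bullet> y\<close> cancels when the square is expanded. What remains is linear in
  \<open>y\<close>: for fixed \<open>z\<close> the admissible centres form a half-space.\<close>

lemma mem_cball_norm_iff:
  fixes y z :: "'a::real_inner"
  shows "z \<in> cball y (norm y) \<longleftrightarrow> z \<bullet> z \<le> 2 * (y \<bullet> z)"
proof -
  have "z \<in> cball y (norm y) \<longleftrightarrow> (y - z) \<bullet> (y - z) \<le> y \<bullet> y"
    by (simp add: dist_norm norm_le)
  also have "\<dots> \<longleftrightarrow> z \<bullet> z \<le> 2 * (y \<bullet> z)"
    by (simp add: inner_diff inner_commute)
  finally show ?thesis .
qed

lemma norm_le_sqrt_iff: "norm (x :: 'a::real_inner) \<le> sqrt c \<longleftrightarrow> x \<bullet> x \<le> c"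
  by (simp add: norm_eq_sqrt_inner)

lemma mem_cball_half_sqrt_iff:
  fixes a x :: "'a::real_inner"
  shows "x \<in> cball (a /\<^sub>R 2) (sqrt c) \<longleftrightarrow> (a \<bullet> a) / 4 - a \<bullet> x + x \<bullet> x \<le> c"
  unfolding mem_cball dist_norm norm_le_sqrt_iff
  by (simp add: inner_diff inner_commute field_simps) linarith

section \<open>Volumes of caps of the unit ball\<close>

lemma compact_cap: "compact {y \<in> cball (0::'a::euclidean_space) r. c \<le> z \<bullet> y}"
proof -
  have "closed {y. c \<le> z \<bullet> y}"
    by (intro closed_Collect_le continuous_intros)
  then show ?thesis
    using compact_Int_closed[OF compact_cball, of "{y. c \<le> z \<bullet> y}" 0 r]
    by (simp add: Int_def)
qed

text \<open>The cap and its reflection through the origin have equal volume, both lie in the unit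
  ball, and they are disjoint because \<open>z \<bullet> y\<close> is positive on one and negative
  on the other.\<close>

lemma content_cap_le_half:
  fixes z :: "'a::euclidean_space"
  assumes "0 < c"
  shows "measure lborel {y \<in> cball 0 1. c \<le> z \<bullet> y} \<le> unit_ball_vol DIM('a) / 2"
proof -
  define A where "A = {y \<in> cball 0 1. c \<le> z \<bullet> y}"
  have cA: "compact A" unfolding A_def by (rule compact_cap)
  have cB: "compact (uminus ` A)" using cA by (rule compact_negations)
  have mA: "A \<in> lmeasurable" "uminus ` A \<in> lmeasurable"
    using cA cB by (auto intro: lmeasurable_compact)
  have disj: "A \<inter> uminus ` A = {}"
    using assms by (auto simp: A_def)
  have "measure lebesgue (uminus ` A) = measure lebesgue A"
    using measure_lebesgue_affine[of "-1" 0 A] by simp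
  then have "2 * measure lebesgue A = measure lebesgue (A \<union> uminus ` A)"
    using measure_Un2[OF mA] disj by (simp add: Diff_triv Int_commute)
  also have "\<dots> \<le> measure lebesgue (cball (0::'a) 1)"
    using mA by (intro measure_mono_fmeasurable) (auto simp: A_def)
  also have "\<dots> = unit_ball_vol DIM('a)"
    by (simp add: content_cball)
  finally show ?thesis
    unfolding A_def[symmetric] using cA by (simp add: borel_compact)
qed

text \<open>On the cap, the squared distance from \<open>y\<close> to \<open>z/2\<close> is at most
  \<open>1 - (z \<bullet> z) / 4\<close>, hence at most 3/4 once \<open>z\<close> has norm at least
  1.\<close>

lemma content_cap_le_cball:
  fixes z :: "'a::euclidean_space"
  assumes "1 \<le> norm z"
  shows "measure lborel {y \<in> cball 0 1. z \<bullet> z \<le> 2 * (z \<bullet> y)} \<le> unit_ball_vol DIM('a) * sqrt (3/4) ^ DIM('a)"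
proof -
  have "{y \<in> cball 0 1. z \<bullet> z \<le> 2 * (z \<bullet> y)} \<subseteq> cball (z /\<^sub>R 2) (sqrt (3/4))"
  proof
    fix y assume y: "y \<in> {y \<in> cball 0 1. z \<bullet> z \<le> 2 * (z \<bullet> y)}"
    have "1 \<le> z \<bullet> z" "y \<bullet> y \<le> 1"
      using assms y norm_le_sqrt_iff[of y 1] by (simp_all add: norm_eq_sqrt_inner)
    with y show "y \<in> cball (z /\<^sub>R 2) (sqrt (3/4))"
      unfolding mem_cball_half_sqrt_iff by simp
  qed
  then have "measure lborel {y \<in> cball 0 1. z \<bullet> z \<le> 2 * (z \<bullet> y)} \<le> measure lborel (cball (z /\<^sub>R 2) (sqrt (3/4)))"
    using compact_cap[of 1 "z \<bullet> z / 2" z]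
    by (intro measure_mono_fmeasurable)
       (auto simp: mult.commute borel_compact fmeasurable_compact)
  then show ?thesis
    by (simp add: content_cball)
qed

text \<open>Merges the two cap estimates into one bound that is a sum of indicators of balls, ready
  to be integrated over \<open>z\<close>.\<close>

lemma emeasure_cap_le:
  fixes e z :: "'a::euclidean_space"
  assumes e: "norm e = 1" and z: "z \<in> cball e 1" "z \<noteq> 0"
  shows "emeasure lborel {y \<in> cball 0 1. z \<bullet> z \<le> 2 * (z \<bullet> y)} \<le>
    ennreal (unit_ball_vol DIM('a) * sqrt (3/4) ^ DIM('a)) * indicator (cball e 1) z +
    ennreal (unit_ball_vol DIM('a) / 2) * indicator (cball (e /\<^sub>R 2) (sqrt (3/4))) z"
proof -
  let ?A = "{y \<in> cball 0 1. z \<bullet> z \<le> 2 * (z \<bullet> y)}"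
  have eq: "?A = {y \<in> cball 0 1. z \<bullet> z / 2 \<le> z \<bullet> y}" by auto
  have "emeasure lborel ?A < \<infinity>"
    unfolding eq by (rule emeasure_compact_finite[OF compact_cap])
  then have em: "emeasure lborel ?A = ennreal (measure lborel ?A)"
    by (simp add: emeasure_eq_ennreal_measure less_top[symmetric])
  show ?thesis
  proof (cases "1 \<le> norm z")
    case True
    with em content_cap_le_cball[OF True] z show ?thesis
      by (auto intro!: add_increasing2 ennreal_leI)
  next
    case False
    have "z \<bullet> z \<le> 1"
      using False norm_le_sqrt_iff[of z 1] by simp
    moreover have "z \<bullet> z \<le> 2 * (e \<bullet> z)"
      using z(1) e mem_cball_norm_iff[of z e] by simp
    moreover have "e \<bullet> e = 1"
      using e by (simp add: norm_eq_1)
    \<comment> \<open>The squared distance from \<open>z\<close> to \<open>e/2\<close> is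
      \<open>1/4 - e \<bullet> z + z \<bullet> z\<close>, at most
      \<open>1/4 + (z \<bullet> z) / 2 \<le> 3/4\<close>.\<close>
    ultimately have "z \<in> cball (e /\<^sub>R 2) (sqrt (3/4))"
      unfolding mem_cball_half_sqrt_iff by simp
    moreover have "measure lborel ?A \<le> unit_ball_vol DIM('a) / 2"
      \<comment> \<open>Here \<open>z \<noteq> 0\<close> makes the threshold
        \<open>z \<bullet> z / 2\<close> positive.\<close>
      unfolding eq by (rule content_cap_le_half) (use z(2) in simp)
    ultimately show ?thesis
      using em by (auto intro!: add_increasing ennreal_leI)
  qed
qed

lemma sets_overlap_pairs:

  \<comment> \<open>Mean overlap by Fubini\<close>
  "{(y::'a::euclidean_space, z). z \<in> cball e r \<and> z \<bullet> z \<le> 2 * (y \<bullet> z)} \<in> sets (lborel \<Otimes>\<^sub>M lborel)"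
proof -
  have "closed {p :: 'a \<times> 'a. dist e (snd p) \<le> r \<and> snd p \<bullet> snd p \<le> 2 * (fst p \<bullet> snd p)}"
    by (intro closed_Collect_conj closed_Collect_le continuous_intros)
  then have "{(y::'a, z). z \<in> cball e r \<and> z \<bullet> z \<le> 2 * (y \<bullet> z)} \<in> sets borel"
    by (simp add: case_prod_beta')
  then show ?thesis
    by (simp only: lborel_prod sets_lborel)
qed

text \<open>As slices of one measurable set of pairs, the overlaps have a volume that is measurable
  in \<open>y\<close>.\<close>

lemma overlap_eq_vimage:
  "cball e r \<inter> cball y (norm y) = Pair y -` {(y::'a::euclidean_space, z). z \<in> cball e r \<and> z \<bullet> z \<le> 2 * (y \<bullet> z)}"
  by (simp add: set_eq_iff mem_cball_norm_iff del: mem_cball)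

lemma borel_measurable_overlap [measurable]:
  "(\<lambda>y::'a::euclidean_space. emeasure lborel (cball e r \<inter> cball y (norm y))) \<in> borel_measurable borel"
  unfolding overlap_eq_vimage
  using lborel.measurable_emeasure_Pair[OF sets_overlap_pairs, of e r] by simp

lemma nn_integral_overlap_le:
  fixes e :: "'a::euclidean_space"
  assumes e: "norm e = 1"
  defines "V \<equiv> unit_ball_vol DIM('a)"
  shows "(\<integral>\<^sup>+y. emeasure lborel (cball e 1 \<inter> cball y (norm y)) * indicator (cball 0 1) y \<partial>lborel)
    \<le> ennreal (3/2 * sqrt (3/4) ^ DIM('a) * V\<^sup>2)"
proof -
  have V: "0 \<le> V" by (simp add: V_def)
  have [measurable]: "cball (0::'a) 1 \<in> sets borel"
    by simp
  have meas: "(\<lambda>z. ennreal b * indicator (cball a r) z) \<in> borel_measurable lborel"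
    for a :: 'a and b r
    by (intro borel_measurable_times_ennreal borel_measurable_const borel_measurable_indicator) simp
  define S where "S = {(y::'a, z). z \<in> cball e 1 \<and> z \<bullet> z \<le> 2 * (y \<bullet> z)}"
  have S [measurable]: "S \<in> sets (lborel \<Otimes>\<^sub>M lborel)"
    unfolding S_def by (rule sets_overlap_pairs)
  have "(\<integral>\<^sup>+y. emeasure lborel (cball e 1 \<inter> cball y (norm y)) * indicator (cball 0 1) y \<partial>lborel)
    = (\<integral>\<^sup>+y. (\<integral>\<^sup>+z. indicator S (y, z) * indicator (cball 0 1) y \<partial>lborel) \<partial>lborel)"
  proof (intro nn_integral_cong)
    fix y :: 'a
    have "(\<integral>\<^sup>+z. indicator S (y, z) * indicator (cball 0 1) y \<partial>lborel)
      = (\<integral>\<^sup>+z. indicator (cball e 1 \<inter> cball y (norm y)) z * indicator (cball 0 1) y \<partial>lborel)"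
      by (intro nn_integral_cong)
         (simp add: S_def mem_cball_norm_iff indicator_def del: mem_cball)
    also have "\<dots> = emeasure lborel (cball e 1 \<inter> cball y (norm y)) * indicator (cball 0 1) y"
      by (subst nn_integral_multc) (auto intro!: borel_measurable_indicator)
    finally show "emeasure lborel (cball e 1 \<inter> cball y (norm y)) * indicator (cball 0 1) y
      = (\<integral>\<^sup>+z. indicator S (y, z) * indicator (cball 0 1) y \<partial>lborel)" ..
  qed
  also have "\<dots> = (\<integral>\<^sup>+z. (\<integral>\<^sup>+y. indicator S (y, z) * indicator (cball 0 1) y \<partial>lborel) \<partial>lborel)"
    by (rule lborel_pair.Fubini'[symmetric]) measurable
  \<comment> \<open>With \<open>z\<close> fixed, the slice in \<open>y\<close> is a cap of the unit
    ball.\<close>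
  also have "\<dots> = (\<integral>\<^sup>+z. emeasure lborel {y \<in> cball 0 1. z \<bullet> z \<le> 2 * (z \<bullet> y)} * indicator (cball e 1) z \<partial>lborel)"
  proof (intro nn_integral_cong)
    fix z :: 'a
    let ?A = "{y \<in> cball 0 1. z \<bullet> z \<le> 2 * (z \<bullet> y)}"
    have [measurable]: "?A \<in> sets borel"
      using borel_compact[OF compact_cap[of 1 "z \<bullet> z / 2" z]] by (simp add: mult.commute)
    have "(\<integral>\<^sup>+y. indicator S (y, z) * indicator (cball 0 1) y \<partial>lborel)
      = (\<integral>\<^sup>+y. indicator ?A y * indicator (cball e 1) z \<partial>lborel)"
      by (intro nn_integral_cong) (auto simp: S_def indicator_def inner_commute)
    then show "(\<integral>\<^sup>+y. indicator S (y, z) * indicator (cball 0 1) y \<partial>lborel)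
      = emeasure lborel ?A * indicator (cball e 1) z"
      by (simp add: nn_integral_multc)
  qed
  also have "\<dots> \<le> (\<integral>\<^sup>+z. ennreal (V * sqrt (3/4) ^ DIM('a)) * indicator (cball e 1) z
      + ennreal (V / 2) * indicator (cball (e /\<^sub>R 2) (sqrt (3/4))) z \<partial>lborel)"
  \<comment> \<open>At the origin the cap is the whole unit ball, so this null point is left
    out.\<close>
  proof (intro nn_integral_mono_AE, use AE_lborel_singleton[of "0::'a"] in eventually_elim)
    fix z :: 'a assume "z \<noteq> 0"
    then show "emeasure lborel {y \<in> cball 0 1. z \<bullet> z \<le> 2 * (z \<bullet> y)} * indicator (cball e 1) z
      \<le> ennreal (V * sqrt (3/4) ^ DIM('a)) * indicator (cball e 1) z
      + ennreal (V / 2) * indicator (cball (e /\<^sub>R 2) (sqrt (3/4))) z"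
      using emeasure_cap_le[OF e, of z]
      by (cases "z \<in> cball e 1") (simp_all add: V_def del: mem_cball)
  qed
  also have "\<dots> = ennreal (V * sqrt (3/4) ^ DIM('a)) * emeasure lborel (cball e 1)
      + ennreal (V / 2) * emeasure lborel (cball (e /\<^sub>R 2) (sqrt (3/4)))"
    by (simp add: nn_integral_add[OF meas meas] nn_integral_cmult_indicator)
  \<comment> \<open>With \<open>s = sqrt (3/4)\<close> and \<open>d\<close> the dimension, the terms
    are \<open>V * s^d * V\<close> and \<open>V/2 * (V * s^d)\<close>; hence the factor 3/2.\<close>
  also have "\<dots> = ennreal (3/2 * sqrt (3/4) ^ DIM('a) * V\<^sup>2)"
    using V by (simp add: emeasure_cball V_def[symmetric] ennreal_mult[symmetric]
        ennreal_plus[symmetric] power2_eq_square algebra_simps del: ennreal_plus)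
  finally show ?thesis .
qed

section \<open>The law of the \<open>d\<close>-th power of the norm\<close>

lemma prob_space_uniform_unit_cball:
  "prob_space (uniform_measure lborel (cball (0::'a::euclidean_space) 1))"
  by (rule prob_space_uniform_measure) (simp_all add: emeasure_cball ennreal_eq_0_iff not_le)

text \<open>Volume scales as the \<open>d\<close>-th power of the radius, so the distribution
  function is the identity on \<open>[0, 1]\<close>; laws on the line with equal distribution
  functions agree.\<close>

lemma distr_norm_power_uniform_ball:
  "distr (uniform_measure lborel (cball (0::'a::euclidean_space) 1)) borel (\<lambda>y. norm y ^ DIM('a))
    = uniform_measure lborel {0..1}" (is "distr ?P borel ?f = ?U")
proof (rule cdf_unique)
  interpret P: prob_space ?P
    by (rule prob_space_uniform_unit_cball)
  interpret U: prob_space ?U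
    by (rule prob_space_uniform_measure) auto
  show "real_distribution (distr ?P borel ?f)"
    by simp
  show "real_distribution ?U"
    by (simp add: real_distribution_def real_distribution_axioms_def U.prob_space_axioms)
  show "cdf (distr ?P borel ?f) = cdf ?U"
  proof
    fix u :: real
    have "cdf (distr ?P borel ?f) u = measure ?P (?f -` {..u})"
      by (simp add: cdf_def measure_distr)
    also have "\<dots> = measure lborel (cball 0 1 \<inter> ?f -` {..u}) / unit_ball_vol DIM('a)"
      using measurable_sets[of ?f borel borel "{..u}"]
      by (subst measure_uniform_measure)
         (auto simp: emeasure_cball content_cball ennreal_eq_0_iff not_le)
    also have "\<dots> = measure lborel ({0..1} \<inter> {..u})"
    proof -
      consider "u < 0" | "0 \<le> u" "u \<le> 1" | "1 < u" by linarith
      then show ?thesis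
      proof cases
        case 1
        then have "\<not> norm y ^ DIM('a) \<le> u" for y :: 'a
          using zero_le_power[OF norm_ge_zero, of y "DIM('a)"] by linarith
        then have "cball 0 1 \<inter> ?f -` {..u} = {}"
          by auto
        moreover have "{0..1} \<inter> {..u} = {}" using 1 by auto
        ultimately show ?thesis by simp
      next
        case 2
        \<comment> \<open>The radius whose ball fills the fraction \<open>u\<close> of the unit
          ball.\<close>
        let ?r = "root DIM('a) u"
        have r: "?r ^ DIM('a) = u" "0 \<le> ?r" "?r \<le> 1"
          using 2 by (simp_all add: real_root_pow_pos2)
        have "norm y ^ DIM('a) \<le> u \<longleftrightarrow> norm y \<le> ?r" for y :: 'a
          using power_mono_iff[of "norm y" ?r "DIM('a)"] r by simp
        then have "cball 0 1 \<inter> ?f -` {..u} = cball 0 ?r"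
          by (auto intro: order_trans[OF _ r(3)])
        moreover have "{0..1} \<inter> {..u} = {0..u}" using 2 by auto
        ultimately show ?thesis
          using r 2 by (simp add: content_cball)
      next
        case 3
        then have "norm y ^ DIM('a) \<le> u" if "norm y \<le> 1" for y :: 'a
          using power_le_one[OF norm_ge_zero that, of "DIM('a)"] by linarith
        then have "cball 0 1 \<inter> ?f -` {..u} = cball 0 1"
          by auto
        moreover have "{0..1} \<inter> {..u} = {0..1}" using 3 by auto
        ultimately show ?thesis by (simp add: content_cball)
      qed
    qed
    also have "\<dots> = cdf ?U u"
      by (simp add: cdf_def)
    finally show "cdf (distr ?P borel ?f) u = cdf ?U u" .
  qed
qed

section \<open>The main term and its perturbation\<close>

lemma integral_uniform_inverse_square:
  "(\<integral>u. 2 / (1 + u)\<^sup>2 \<partial>uniform_measure lborel {0..1::real}) = 1"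
proof -
  \<comment> \<open>The antiderivative is \<open>-2 / (1 + u)\<close>.\<close>
  have "(\<integral>\<^sup>+u. ennreal (2 / (1 + u)\<^sup>2) * indicator {0..1} u \<partial>lborel) = ennreal ((-2 / (1 + 1)) - (-2 / (1 + 0)))"
    by (rule nn_integral_FTC_Icc)
       (auto intro!: derivative_eq_intros simp: power2_eq_square field_simps)
  then show ?thesis
    by (intro integral_eq_nn_integral[THEN trans])
       (simp_all add: nn_integral_uniform_measure)
qed

text \<open>With \<open>a = 1 + u\<close> and \<open>w = a - i \<ge> 1\<close>, factoring
  \<open>a\<^sup>2 - w\<^sup>2\<close> writes the difference as \<open>2 * i\<close> times two
  reciprocals, each at most 1; hence the constant 4.\<close>

lemma inverse_square_perturb:
  fixes u i :: real
  assumes "0 \<le> i" "i \<le> u"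
  shows "2 / (1 + u)\<^sup>2 \<le> 2 / (1 + u - i)\<^sup>2" "2 / (1 + u - i)\<^sup>2 \<le> 2 / (1 + u)\<^sup>2 + 4 * i"
proof -
  define a w where "a = 1 + u" and "w = a - i"
  have w: "1 \<le> w" "w \<le> a" "i = a - w" using assms by (auto simp: a_def w_def)
  show "2 / (1 + u)\<^sup>2 \<le> 2 / (1 + u - i)\<^sup>2"
    unfolding a_def[symmetric] w_def[symmetric]
    using w by (intro divide_left_mono power_mono mult_pos_pos) auto
  have "1 \<le> a * w\<^sup>2" "1 \<le> a\<^sup>2 * w"
    using w by (auto intro!: mult_ge1_I)
  then have "1 / (a * w\<^sup>2) \<le> 1" "1 / (a\<^sup>2 * w) \<le> 1"
    by simp_all
  then have "2 * i * (1 / (a * w\<^sup>2) + 1 / (a\<^sup>2 * w)) \<le> 2 * i * (1 + 1)"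
    using assms by (intro mult_left_mono add_mono) auto
  moreover have "2 / w\<^sup>2 - 2 / a\<^sup>2 = 2 * i * (1 / (a * w\<^sup>2) + 1 / (a\<^sup>2 * w))"
    using w(1,2) unfolding w(3) by (simp add: field_simps power2_eq_square)
  ultimately show "2 / (1 + u - i)\<^sup>2 \<le> 2 / (1 + u)\<^sup>2 + 4 * i"
    unfolding a_def[symmetric] w_def[symmetric] by simp
qed

section \<open>The normalised overlap and its expectation\<close>

definition overlap_ratio :: "'a::euclidean_space \<Rightarrow> 'a \<Rightarrow> real" where
  "overlap_ratio e y = measure lborel (cball e 1 \<inter> cball y (norm y)) / unit_ball_vol DIM('a)"

lemma overlap_ratio_nonneg: "0 \<le> overlap_ratio e y"
  by (simp add: overlap_ratio_def)

lemma overlap_ratio_le: "overlap_ratio e y \<le> norm (y::'a::euclidean_space) ^ DIM('a)"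
proof -
  have "measure lborel (cball e 1 \<inter> cball y (norm y)) \<le> measure lborel (cball y (norm y))"
    by (intro measure_mono_fmeasurable) (auto simp: fmeasurable_compact)
  then show ?thesis
    by (simp add: overlap_ratio_def content_cball divide_le_eq mult.commute)
qed

lemma borel_measurable_overlap_ratio [measurable]: "overlap_ratio e \<in> borel_measurable borel"
  unfolding overlap_ratio_def measure_def by measurable

text \<open>Inclusion-exclusion, divided by the volume of the unit ball.\<close>

lemma union_ratio_eq:
  fixes y :: "real ^ 'n::finite"
  shows "union_ratio k y = 1 + norm y ^ CARD('n) - overlap_ratio (axis k 1) y"
proof -
  define e where "e = (axis k 1 :: real ^ 'n)"
  have "measure lebesgue (cball e 1 \<union> cball y (norm y)) =
      measure lborel (cball e 1) + measure lborel (cball y (norm y))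
      - measure lborel (cball e 1 \<inter> cball y (norm y))"
    using measure_Un3[of "cball e 1" lborel "cball y (norm y)"]
    by (simp add: fmeasurable_compact)
  then show ?thesis
    unfolding e_def[symmetric] union_ratio_def
    by (simp add: overlap_ratio_def content_cball field_simps)
qed

text \<open>One factor \<open>1 / ?V\<close> normalises the overlap and another is the density of
  the uniform law; together they cancel the \<open>?V\<^sup>2\<close> of the Fubini bound.\<close>

lemma expected_overlap_ratio_le:
  fixes e :: "'a::euclidean_space"
  assumes "norm e = 1"
  shows "(\<integral>y. overlap_ratio e y \<partial>uniform_measure lborel (cball 0 1)) \<le> 3/2 * sqrt (3/4) ^ DIM('a)"
proof (rule integral_real_bounded)
  let ?V = "unit_ball_vol DIM('a)"
  have "(\<integral>\<^sup>+y. ennreal (overlap_ratio e y) \<partial>uniform_measure lborel (cball 0 1))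
    = (\<integral>\<^sup>+y. ennreal (1 / ?V) * (emeasure lborel (cball e 1 \<inter> cball y (norm y)) * indicator (cball 0 1) y) \<partial>lborel) / ennreal ?V"
  proof -
    have "ennreal (overlap_ratio e y)
      = ennreal (1 / ?V) * emeasure lborel (cball e 1 \<inter> cball y (norm y))" for y
    proof -
      have "emeasure lborel (cball e 1 \<inter> cball y (norm y))
        = ennreal (measure lborel (cball e 1 \<inter> cball y (norm y)))"
        by (intro emeasure_eq_ennreal_measure)
           (metis compact_Int compact_cball emeasure_compact_finite infinity_ennreal_def less_irrefl)
      then show ?thesis
        by (simp add: overlap_ratio_def ennreal_mult[symmetric])
    qed
    then show ?thesis
      by (simp add: nn_integral_uniform_measure emeasure_cball mult.assoc)
  qed
  also have "\<dots> = ennreal (1 / ?V) *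
      (\<integral>\<^sup>+y. emeasure lborel (cball e 1 \<inter> cball y (norm y)) * indicator (cball 0 1) y \<partial>lborel) / ennreal ?V"
    by (subst nn_integral_cmult)
       (auto intro!: borel_measurable_times_ennreal borel_measurable_overlap borel_measurable_indicator)
  also have "\<dots> \<le> ennreal (1 / ?V) * ennreal (3/2 * sqrt (3/4) ^ DIM('a) * ?V\<^sup>2) / ennreal ?V"
    by (intro divide_right_mono_ennreal mult_left_mono nn_integral_overlap_le assms) simp
  also have "\<dots> = ennreal (3/2 * sqrt (3/4) ^ DIM('a))"
    by (simp add: ennreal_mult[symmetric] divide_ennreal power2_eq_square)
  finally show "(\<integral>\<^sup>+y. ennreal (overlap_ratio e y) \<partial>uniform_measure lborel (cball 0 1))
    \<le> ennreal (3/2 * sqrt (3/4) ^ DIM('a))" .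
qed simp

section \<open>Assembling the bounds on the expectation\<close>

theorem theorem3:
  fixes k :: "'n::finite" and M :: "'w measure" and Y :: "'w \<Rightarrow> real ^ 'n"
  assumes "prob_space M"
    and "uniform_unit_ball M Y"
  shows "1 \<le> alpha k M Y \<and> alpha k M Y \<le> 1 + 6 * (3 / 4) powr (real CARD('n) / 2)"
proof -
  define P where "P = uniform_measure lborel (cball (0 :: real ^ 'n) 1)"
  define U where "U y = norm y ^ CARD('n)" for y :: "real ^ 'n"
  define I where "I = overlap_ratio (axis k 1 :: real ^ 'n)"
  have setsP [measurable_cong]: "sets P = sets borel" by (simp add: P_def)
  have [measurable]: "U \<in> borel_measurable borel" "I \<in> borel_measurable borel"
    by (simp_all add: U_def[abs_def] I_def)
  interpret P: prob_space P
    unfolding P_def by (rule prob_space_uniform_unit_cball)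
  have Y: "Y \<in> borel_measurable M" "distr M borel Y = P"
    using assms(2) by (simp_all add: uniform_unit_ball_def P_def)
  have I: "0 \<le> I y" "I y \<le> U y" for y
    using overlap_ratio_le[of "axis k 1" y] by (simp_all add: I_def U_def overlap_ratio_nonneg)
  \<comment> \<open>\<open>P\<close> is concentrated on the unit ball, which bounds \<open>U\<close>
    and hence \<open>I\<close>.\<close>
  have "AE y in P. U y \<le> 1"
    unfolding P_def by (rule AE_uniform_measureI) (auto simp: U_def power_le_one)
  with I have I1: "AE y in P. norm (I y) \<le> 1"
    by (auto elim!: eventually_mono intro: order_trans)
  \<comment> \<open>Both denominators are at least 1 because \<open>0 \<le> I y \<le> U y\<close>;
    the constant 2 then gives integrability.\<close>
  have W2: "2 / (1 + U y - I y)\<^sup>2 \<le> 2" "2 / (1 + U y)\<^sup>2 \<le> 2" for y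
    using I[of y] by (auto simp: divide_le_eq)
  have int: "integrable P (\<lambda>y. 2 / (1 + U y - I y)\<^sup>2)" "integrable P (\<lambda>y. 2 / (1 + U y)\<^sup>2)"
    using W2 by (auto intro!: P.integrable_const_bound[where B = 2])
  have intI: "integrable P I"
    using I1 by (intro P.integrable_const_bound[where B = 1]) auto
  have "alpha k M Y = (\<integral>y. 2 / (1 + U y - I y)\<^sup>2 \<partial>distr M borel Y)"
    unfolding alpha_def union_ratio_eq U_def[symmetric] I_def[symmetric]
    by (rule integral_distr[symmetric, OF Y(1)]) measurable
  then have alpha: "alpha k M Y = (\<integral>y. 2 / (1 + U y - I y)\<^sup>2 \<partial>P)"
    by (simp add: Y(2))
  \<comment> \<open>A further push-forward along \<open>U\<close> reduces the main term to an
    integral over \<open>[0, 1]\<close>.\<close>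
  have "(\<integral>y. 2 / (1 + U y)\<^sup>2 \<partial>P) = (\<integral>u. 2 / (1 + u)\<^sup>2 \<partial>distr P borel U)"
    by (rule integral_distr[symmetric]) measurable
  also have "distr P borel U = uniform_measure lborel {0..1}"
    using distr_norm_power_uniform_ball[where 'a = "real ^ 'n"] by (simp add: P_def U_def[abs_def])
  finally have one: "(\<integral>y. 2 / (1 + U y)\<^sup>2 \<partial>P) = 1"
    by (simp add: integral_uniform_inverse_square)
  have "(\<integral>y. 2 / (1 + U y)\<^sup>2 \<partial>P) \<le> alpha k M Y"
    unfolding alpha
    using int inverse_square_perturb(1)[OF I] by (intro integral_mono) auto
  moreover have "alpha k M Y \<le> (\<integral>y. 2 / (1 + U y)\<^sup>2 + 4 * I y \<partial>P)"
    unfolding alpha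
    using int intI inverse_square_perturb(2)[OF I] by (intro integral_mono) auto
  moreover have "(\<integral>y. 2 / (1 + U y)\<^sup>2 + 4 * I y \<partial>P) = 1 + 4 * (\<integral>y. I y \<partial>P)"
    using int intI by (simp add: one)
  moreover have "(\<integral>y. I y \<partial>P) \<le> 3/2 * sqrt (3/4) ^ CARD('n)"
    using expected_overlap_ratio_le[of "axis k 1 :: real ^ 'n"] by (simp add: I_def P_def)
  \<comment> \<open>Converts to the stated exponent; the constant 6 is
    \<open>4 * 3/2\<close>.\<close>
  moreover have "sqrt (3/4) ^ CARD('n) = (3/4) powr (real CARD('n) / 2)"
    by (simp add: powr_half_sqrt[symmetric] powr_realpow[symmetric] powr_powr)
  ultimately show ?thesis
    unfolding one by linarith
qed

end
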